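(* Let $S$ be a finite set and let $p\notin S$. Let $\mathrm{Semimat}(S)$ be the set of semimatroids on $S$, and let $\mathrm{Pointedmat}(S,p)$ be the set of pairs $(\widetilde{N},p)$ where $\widetilde{N}$ is a matroid on $S\cup\{p\}$ such that $p$ is not a loop of $\widetilde{N}$. 1. For $(\widetilde{N},p)\in\mathrm{Pointedmat}(S,p)$, let $\mathcal{C}=\{A\subseteq S\mid p\notin \mathrm{cl}_{\widetilde{N}}(A)\}$ and let $r_{\mathcal{C}}$ be the restriction of $r_{\widetilde{N}}$ to $\mathcal{C}$. Then $(S,\mathcal{C},r_{\mathcal{C}})$ is a semimatroid. 2. For $(S,\mathcal{C},r_{\mathcal{C}})\in\mathrm{Semimat}(S)$, define $r_{\widetilde{N}}:2^{S\cup\{p\}}\to\mathbb{N}$ by $$r_{\widetilde{N}}(A)=\begin{cases} r_{\mathcal{C}}(A) & \text{if } A\in\mathcal{C},\\ \max\{r_{\mathcal{C}}(B)\mid B\subseteq A,\ B\in\mathcal{C}\}+1 & \text{if } A\notin\mathcal{C},\end{cases}$$ $$r_{\widetilde{N}}(A\cup\{p\})=\begin{cases} r_{\widetilde{N}}(A)+1 & \text{if } A\in\mathcal{C},\\ r_{\widetilde{N}}(A) & \text{if } A\notin\mathcal{C},\end{cases}$$ for $A\subseteq S$. Then $r_{\widetilde{N}}$ is the rank function of a matroid $\widetilde{N}$ on $S\cup\{p\}$, and $(\widetilde{N},p)\in\mathrm{Pointedmat}(S,p)$. 3. The map $\mathrm{Pointedmat}(S,p)\to\mathrm{Semimat}(S)$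 sending $(\widetilde{N},p)$ to the semimatroid $(S,\mathcal{C},r_{\mathcal{C}})$ with $\mathcal{C}=\{A\subseteq S\mid p\notin \mathrm{cl}_{\widetilde{N}}(A)\}$ and $r_{\mathcal{C}}=r_{\widetilde{N}}|_{\mathcal{C}}$, and the map $\mathrm{Semimat}(S)\to\mathrm{Pointedmat}(S,p)$ sending $(S,\mathcal{C},r_{\mathcal{C}})$ to the pair $(\widetilde{N},p)$, where $\widetilde{N}$ is the matroid on $S\cup\{p\}$ whose rank function is given, for $A\subseteq S$, by $r_{\widetilde{N}}(A)=r_{\mathcal{C}}(A)$ and $r_{\widetilde{N}}(A\cup\{p\})=r_{\mathcal{C}}(A)+1$ if $A\in\mathcal{C}$, and by $r_{\widetilde{N}}(A)=r_{\widetilde{N}}(A\cup\{p\})=\max\{r_{\mathcal{C}}(B)\mid B\subseteq A,\ B\in\mathcal{C}\}+1$ if $A\notin\mathcal{C}$, are inverses. They establish a one-to-one correspondence between $\mathrm{Pointedmat}(S,p)$ and $\mathrm{Semimat}(S)$.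
   Context: $\mathbb{N}$ includes $0$. A simplicial complex on a finite set $S$ is a family of subsets of $S$ closed under taking subsets; singletons need not belong to it. A semimatroid is a triple $(S,\mathcal{C},r_{\mathcal{C}})$ consisting of a finite set $S$, a non-empty simplicial complex $\mathcal{C}$ on $S$, and a function $r_{\mathcal{C}}:\mathcal{C}\to\mathbb{N}$ such that: (R1) if $X\in\mathcal{C}$ then $0\le r_{\mathcal{C}}(X)\le |X|$; (R2) if $X,Y\in\mathcal{C}$ and $X\subseteq Y$ then $r_{\mathcal{C}}(X)\le r_{\mathcal{C}}(Y)$; (R3) if $X,Y\in\mathcal{C}$ and $X\cup Y\in\mathcal{C}$ then $r_{\mathcal{C}}(X)+r_{\mathcal{C}}(Y)\ge r_{\mathcal{C}}(X\cup Y)+r_{\mathcal{C}}(X\cap Y)$; (CR1) if $X,Y\in\mathcal{C}$ and $r_{\mathcal{C}}(X)=r_{\mathcal{C}}(X\cap Y)$ then $X\cup Y\in\mathcal{C}$; (CR2) if $X,Y\in\mathcal{C}$ and $r_{\mathcal{C}}(X)<r_{\mathcal{C}}(Y)$ then $X\cup\{y\}\in\mathcal{C}$ for some $y\in Y-X$. For a matroid $\widetilde{N}$, $r_{\widetilde{N}}$ is its rank function and $\mathrm{cl}_{\widetilde{N}}$ its closure operator. *)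

theory Defs
  imports Main "HOL-Library.FuncSet"
begin

type_synonym 'a matroid = "'a set \<times> 'a set set"

abbreviation ground :: "'a matroid \<Rightarrow> 'a set" where
  "ground N \<equiv> fst N"

abbreviation indep_sets :: "'a matroid \<Rightarrow> 'a set set" where
  "indep_sets N \<equiv> snd N"

definition is_matroid :: "'a matroid \<Rightarrow> bool" where
  "is_matroid N \<longleftrightarrow>
     finite (ground N) \<and>
     indep_sets N \<subseteq> Pow (ground N) \<and>
     {} \<in> indep_sets N \<and>
     (\<forall>X Y. X \<in> indep_sets N \<and> Y \<subseteq> X \<longrightarrow> Y \<in> indep_sets N) \<and>
     (\<forall>X Y. X \<in> indep_sets N \<and> Y \<in> indep_sets N \<and> card X < card Y \<longrightarrow>
        (\<exists>y \<in> Y - X. X \<union> {y} \<in> indep_sets N))"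

definition matroid_rank :: "'a matroid \<Rightarrow> 'a set \<Rightarrow> nat" where
  "matroid_rank N A = Max (card ` {X \<in> indep_sets N. X \<subseteq> A})"

definition matroid_cl :: "'a matroid \<Rightarrow> 'a set \<Rightarrow> 'a set" where
  "matroid_cl N A = {x \<in> ground N. matroid_rank N (A \<union> {x}) = matroid_rank N A}"

definition is_loop :: "'a matroid \<Rightarrow> 'a \<Rightarrow> bool" where
  "is_loop N e \<longleftrightarrow> e \<in> ground N \<and> {e} \<notin> indep_sets N"

definition is_rank_function_of :: "('a set \<Rightarrow> nat) \<Rightarrow> 'a matroid \<Rightarrow> bool" where
  "is_rank_function_of f N \<longleftrightarrow> (\<forall>A \<subseteq> ground N. f A = matroid_rank N A)"

definition Pointedmat :: "'a set \<Rightarrow> 'a \<Rightarrow> ('a matroid \<times> 'a) set" where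
  "Pointedmat S p =
     {(N, q). q = p \<and> is_matroid N \<and> ground N = S \<union> {p} \<and> \<not> is_loop N p}"

type_synonym 'a semimatroid = "'a set \<times> 'a set set \<times> ('a set \<Rightarrow> nat)"

definition simplicial_complex_on :: "'a set \<Rightarrow> 'a set set \<Rightarrow> bool" where
  "simplicial_complex_on S C \<longleftrightarrow>
     C \<subseteq> Pow S \<and> (\<forall>X Y. X \<in> C \<and> Y \<subseteq> X \<longrightarrow> Y \<in> C)"

text \<open>The rank function of a semimatroid has domain \<open>C\<close> only. It is encoded as an extensional
  function (\<open>undefined\<close> outside \<open>C\<close>), so that equality of triples is equality
  of semimatroids.\<close>

definition is_semimatroid :: "'a semimatroid \<Rightarrow> bool" where
  "is_semimatroid = (\<lambda>(S, C, r).
     finite S \<and> simplicial_complex_on S C \<and> C \<noteq> {} \<and>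
     r \<in> C \<rightarrow>\<^sub>E UNIV \<and>
     (\<forall>X \<in> C. 0 \<le> r X \<and> r X \<le> card X) \<and>
     (\<forall>X \<in> C. \<forall>Y \<in> C. X \<subseteq> Y \<longrightarrow> r X \<le> r Y) \<and>
     (\<forall>X \<in> C. \<forall>Y \<in> C. X \<union> Y \<in> C \<longrightarrow> r X + r Y \<ge> r (X \<union> Y) + r (X \<inter> Y)) \<and>
     (\<forall>X \<in> C. \<forall>Y \<in> C. r X = r (X \<inter> Y) \<longrightarrow> X \<union> Y \<in> C) \<and>
     (\<forall>X \<in> C. \<forall>Y \<in> C. r X < r Y \<longrightarrow> (\<exists>y \<in> Y - X. X \<union> {y} \<in> C)))"

definition Semimat :: "'a set \<Rightarrow> 'a semimatroid set" where
  "Semimat S = {(T, C, r). T = S \<and> is_semimatroid (T, C, r)}"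

definition pointed_complex :: "'a set \<Rightarrow> 'a matroid \<times> 'a \<Rightarrow> 'a set set" where
  "pointed_complex S = (\<lambda>(N, p). {A. A \<subseteq> S \<and> p \<notin> matroid_cl N A})"

definition semimat_of_pointed :: "'a set \<Rightarrow> 'a matroid \<times> 'a \<Rightarrow> 'a semimatroid" where
  "semimat_of_pointed S = (\<lambda>(N, p).
     (S, pointed_complex S (N, p), restrict (matroid_rank N) (pointed_complex S (N, p))))"

definition max_rank_below :: "'a set set \<Rightarrow> ('a set \<Rightarrow> nat) \<Rightarrow> 'a set \<Rightarrow> nat" where
  "max_rank_below C r A = Max {r B | B. B \<subseteq> A \<and> B \<in> C}"

definition rank_on_S :: "'a set set \<Rightarrow> ('a set \<Rightarrow> nat) \<Rightarrow> 'a set \<Rightarrow> nat" where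
  "rank_on_S C r A = (if A \<in> C then r A else max_rank_below C r A + 1)"

text \<open>For \<open>p \<notin> S\<close>, every subset of \<open>S \<union> {p}\<close> is uniquely \<open>A\<close> or \<open>A \<union> {p}\<close> with
  \<open>A \<subseteq> S\<close>; below, \<open>A\<close> is recovered as \<open>X - {p}\<close>.\<close>

definition extended_rank :: "'a \<Rightarrow> 'a set set \<Rightarrow> ('a set \<Rightarrow> nat) \<Rightarrow> 'a set \<Rightarrow> nat" where
  "extended_rank p C r X =
     (if p \<in> X
      then (if X - {p} \<in> C then rank_on_S C r (X - {p}) + 1 else rank_on_S C r (X - {p}))
      else rank_on_S C r X)"

definition has_extended_rank :: "'a \<Rightarrow> 'a semimatroid \<Rightarrow> 'a matroid \<Rightarrow> bool" where
  "has_extended_rank p = (\<lambda>(S, C, r) N.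
     is_matroid N \<and> ground N = S \<union> {p} \<and>
     (\<forall>A \<subseteq> S.
        (A \<in> C \<longrightarrow> matroid_rank N A = r A \<and> matroid_rank N (A \<union> {p}) = r A + 1) \<and>
        (A \<notin> C \<longrightarrow> matroid_rank N A = max_rank_below C r A + 1 \<and>
                   matroid_rank N (A \<union> {p}) = max_rank_below C r A + 1)))"

definition pointed_of_semimat :: "'a \<Rightarrow> 'a semimatroid \<Rightarrow> 'a matroid \<times> 'a" where
  "pointed_of_semimat p M = ((THE N. has_extended_rank p M N), p)"

end

theory Submission
  imports Defs
begin

text \<open>In a pointed matroid, \<open>p \<notin> cl A\<close> says that \<open>r (A \<union> {p}) = r A + 1\<close>; the semimatroid axioms
  for the family of such \<open>A\<close> then come from submodularity and from the closure property
  \<open>r (A \<union> B) = r A\<close> whenever no single element of \<open>B\<close> raises the rank of \<open>A\<close>.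

  Conversely, let \<open>\<rho> A\<close> be the maximum of \<open>r B\<close> over the \<open>B \<in> C\<close> with \<open>B \<subseteq> A\<close>. The candidate rank
  function is then \<open>\<rho> A + [A \<notin> C]\<close> on \<open>A\<close> and \<open>\<rho> A + 1\<close> on \<open>A \<union> {p}\<close>, and the local rank axioms
  (unit increase, and the two-element closure property) are checked for it. The key point is that
  the element supplied by (CR2) can be chosen to raise the rank. Finally, a matroid is determined
  by its rank function, and a basis of \<open>A \<union> {p}\<close> through \<open>p\<close> shows that the two maps are
  mutually inverse.\<close>

section \<open>Rank functions of matroids\<close>

locale matroid =
  fixes N :: "'a matroid"
  assumes is_matroid: "is_matroid N"
begin

abbreviation "rk \<equiv> matroid_rank N"

lemma finite_ground: "finite (ground N)"
  and indep_subset_ground: "X \<in> indep_sets N \<Longrightarrow> X \<subseteq> ground N"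
  and empty_indep: "{} \<in> indep_sets N"
  and indep_mono: "X \<in> indep_sets N \<Longrightarrow> Y \<subseteq> X \<Longrightarrow> Y \<in> indep_sets N"
  and augment: "X \<in> indep_sets N \<Longrightarrow> Y \<in> indep_sets N \<Longrightarrow> card X < card Y \<Longrightarrow>
    \<exists>y \<in> Y - X. insert y X \<in> indep_sets N"
  using is_matroid unfolding is_matroid_def by auto

lemma indep_finite: "X \<in> indep_sets N \<Longrightarrow> finite X"
  using indep_subset_ground finite_ground finite_subset by blast

lemma finite_indep_sets: "finite (indep_sets N)"
proof (rule finite_subset)
  show "indep_sets N \<subseteq> Pow (ground N)"
    using indep_subset_ground by blast
qed (simp add: finite_ground)

lemma card_le_rank: "X \<in> indep_sets N \<Longrightarrow> X \<subseteq> A \<Longrightarrow> card X \<le> rk A"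
  unfolding matroid_rank_def by (rule Max_ge) (auto simp: finite_indep_sets)

lemma obtain_max_indep:
  obtains X where "X \<in> indep_sets N" "X \<subseteq> A" "card X = rk A"
proof -
  have "rk A \<in> card ` {X \<in> indep_sets N. X \<subseteq> A}"
    unfolding matroid_rank_def
    by (rule Max_in) (use empty_indep finite_indep_sets in auto)
  then show ?thesis using that by auto
qed

text \<open>Elements of a maximum independent subset of \<open>A\<close> are added to
  \<open>X\<close> one at a time; the induction is on the deficiency
  \<open>rk A - card X\<close>.\<close>

lemma obtain_basis:
  assumes "X \<in> indep_sets N" "X \<subseteq> A"
  obtains B where "B \<in> indep_sets N" "X \<subseteq> B" "B \<subseteq> A" "card B = rk A"
proof -
  have "\<exists>B. B \<in> indep_sets N \<and> X \<subseteq> B \<and> B \<subseteq> A \<and> card B = rk A"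
    using assms
  proof (induction "rk A - card X" arbitrary: X rule: less_induct)
    case less
    show ?case
    proof (cases "card X < rk A")
      case True
      obtain Y where Y: "Y \<in> indep_sets N" "Y \<subseteq> A" "card Y = rk A"
        by (rule obtain_max_indep)
      obtain y where y: "y \<in> Y - X" "insert y X \<in> indep_sets N"
        using augment[OF less.prems(1) Y(1)] True Y(3) by auto
      have "card (insert y X) = Suc (card X)"
        using y(1) indep_finite[OF less.prems(1)] by auto
      then have "\<exists>B. B \<in> indep_sets N \<and> insert y X \<subseteq> B \<and> B \<subseteq> A \<and> card B = rk A"
        using True Y(2) y less.prems(2) by (intro less.hyps) auto
      then show ?thesis by blast
    next
      case False
      then show ?thesis
        using less.prems card_le_rank[OF less.prems] by (intro exI[of _ X]) auto
    qed
  qed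
  then show ?thesis using that by blast
qed

lemma rank_le_card: "finite A \<Longrightarrow> rk A \<le> card A"
  by (metis obtain_max_indep card_mono)

lemma rank_mono: "A \<subseteq> B \<Longrightarrow> rk A \<le> rk B"
  by (metis obtain_max_indep card_le_rank order_trans)

text \<open>A basis \<open>X\<close> of \<open>A \<inter> B\<close> is extended to a basis
  \<open>Y\<close> of \<open>A \<union> B\<close>. The independent sets \<open>Y \<inter> A\<close>
  and \<open>Y \<inter> B\<close> have union \<open>Y\<close>, and their intersection contains
  \<open>X\<close>.\<close>

lemma rank_submodular: "rk (A \<union> B) + rk (A \<inter> B) \<le> rk A + rk B"
proof -
  obtain X where X: "X \<in> indep_sets N" "X \<subseteq> A \<inter> B" "card X = rk (A \<inter> B)"
    by (rule obtain_max_indep)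
  obtain Y where Y: "Y \<in> indep_sets N" "X \<subseteq> Y" "Y \<subseteq> A \<union> B" "card Y = rk (A \<union> B)"
    using obtain_basis[of X "A \<union> B"] X by blast
  have fin: "finite Y" using Y(1) by (rule indep_finite)
  have "Y \<inter> A \<union> Y \<inter> B = Y" using Y(3) by blast
  then have "card (Y \<inter> A) + card (Y \<inter> B) = card Y + card ((Y \<inter> A) \<inter> (Y \<inter> B))"
    using fin card_Un_Int[of "Y \<inter> A" "Y \<inter> B"] by simp
  moreover have "card X \<le> card ((Y \<inter> A) \<inter> (Y \<inter> B))"
    using X(2) Y(2) fin by (intro card_mono) auto
  moreover have "card (Y \<inter> A) \<le> rk A" "card (Y \<inter> B) \<le> rk B"
    using indep_mono[OF Y(1)] by (auto intro: card_le_rank)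
  ultimately show ?thesis using X(3) Y(4) by linarith
qed

lemma rank_empty: "rk {} = 0"
  using rank_le_card[of "{}"] by simp

lemma rank_insert_le: "rk (insert x A) \<le> rk A + 1"
  using rank_submodular[of A "{x}"] rank_le_card[of "{x}"] by simp

lemma indep_iff_rank: "X \<in> indep_sets N \<longleftrightarrow> X \<subseteq> ground N \<and> rk X = card X"
proof
  assume "X \<in> indep_sets N"
  then show "X \<subseteq> ground N \<and> rk X = card X"
    using indep_subset_ground card_le_rank[of X X] rank_le_card[of X] indep_finite by fastforce
next
  assume X: "X \<subseteq> ground N \<and> rk X = card X"
  obtain Y where "Y \<in> indep_sets N" "Y \<subseteq> X" "card Y = rk X"
    by (rule obtain_max_indep)
  then show "X \<in> indep_sets N"
    using X finite_ground by (metis card_subset_eq finite_subset)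
qed

lemma in_cl_iff: "x \<in> matroid_cl N A \<longleftrightarrow> x \<in> ground N \<and> rk (insert x A) = rk A"
  by (simp add: matroid_cl_def)

lemma rank_insert_if_notin_cl:
  assumes "x \<in> ground N" "x \<notin> matroid_cl N A"
  shows "rk (insert x A) = rk A + 1"
  using assms rank_insert_le[of x A] rank_mono[OF subset_insertI, of A x]
  by (auto simp: in_cl_iff)

end

text \<open>The independent sets are recovered from the rank as the sets whose rank equals their
  cardinality.\<close>

lemma matroid_eqI:
  assumes "is_matroid N" "is_matroid N'" "ground N = ground N'"
    and "\<And>A. A \<subseteq> ground N \<Longrightarrow> matroid_rank N A = matroid_rank N' A"
  shows "N = N'"
proof (rule prod_eqI)
  interpret N: matroid N by standard fact
  interpret N': matroid N' by standard fact
  show "indep_sets N = indep_sets N'"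
    using N.indep_iff_rank N'.indep_iff_rank assms(3,4) by auto
qed fact

section \<open>Matroids from functions satisfying the local rank axioms\<close>

locale local_rank =
  fixes E :: "'a set" and f :: "'a set \<Rightarrow> nat"
  assumes finite_E: "finite E"
    and f_empty: "f {} = 0"
    and f_insert_ge: "A \<subseteq> E \<Longrightarrow> x \<in> E \<Longrightarrow> x \<notin> A \<Longrightarrow> f A \<le> f (insert x A)"
    and f_insert_le: "A \<subseteq> E \<Longrightarrow> x \<in> E \<Longrightarrow> x \<notin> A \<Longrightarrow> f (insert x A) \<le> f A + 1"
    and f_insert2: "A \<subseteq> E \<Longrightarrow> x \<in> E \<Longrightarrow> y \<in> E \<Longrightarrow> x \<notin> A \<Longrightarrow> y \<notin> A \<Longrightarrow> x \<noteq> y \<Longrightarrow>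
      f (insert x A) = f A \<Longrightarrow> f (insert y A) = f A \<Longrightarrow> f (insert x (insert y A)) = f A"
begin

lemma f_Un: "finite Z \<Longrightarrow> A \<subseteq> E \<Longrightarrow> Z \<subseteq> E \<Longrightarrow> f A \<le> f (A \<union> Z) \<and> f (A \<union> Z) \<le> f A + card Z"
proof (induction Z rule: finite_induct)
  case (insert z Z)
  show ?case
  proof (cases "z \<in> A")
    case True
    then show ?thesis using insert by (auto simp: insert_absorb)
  next
    case False
    then show ?thesis
      using insert f_insert_ge[of "A \<union> Z" z] f_insert_le[of "A \<union> Z" z] by auto
  qed
qed simp

lemma f_mono: "A \<subseteq> B \<Longrightarrow> B \<subseteq> E \<Longrightarrow> f A \<le> f B"
  using f_Un[of B A] finite_subset[OF _ finite_E, of B] by (auto simp: Un_absorb1)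

lemma f_le_card: "A \<subseteq> E \<Longrightarrow> f A \<le> card A"
  using f_Un[of A "{}"] finite_subset[OF _ finite_E] by (auto simp: f_empty)

text \<open>Passage from the two-element closure property to arbitrary finite sets: one
  \<open>z\<close> is moved into the base set, and \<open>f_insert2\<close> carries the hypothesis
  for the other elements over to \<open>insert z A\<close>. Hence \<open>A\<close> must vary in the
  induction.\<close>

lemma f_Un_eq:
  assumes "finite Z" "A \<subseteq> E" "Z \<subseteq> E" "\<And>z. z \<in> Z \<Longrightarrow> f (insert z A) = f A"
  shows "f (A \<union> Z) = f A"
  using assms
proof (induction Z arbitrary: A rule: finite_induct)
  case (insert z Z)
  have z: "f (insert z A) = f A" "z \<in> E" using insert.prems by auto
  have "f (insert w (insert z A)) = f (insert z A)" if w: "w \<in> Z" for w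
  proof (cases "w \<in> A \<or> z \<in> A")
    case True
    then show ?thesis using insert.prems w by (auto simp: insert_absorb insert_commute)
  next
    case False
    moreover have "w \<noteq> z" using w insert.hyps by auto
    ultimately show ?thesis using f_insert2[of A w z] insert.prems w by auto
  qed
  then have "f (insert z A \<union> Z) = f (insert z A)"
    using insert.prems by (intro insert.IH) auto
  then show ?case using z by simp
qed simp

definition matroid_of_rank :: "'a matroid" where
  "matroid_of_rank = (E, {X. X \<subseteq> E \<and> f X = card X})"

lemma ground_matroid_of_rank [simp]: "ground matroid_of_rank = E"
  and indep_matroid_of_rank: "X \<in> indep_sets matroid_of_rank \<longleftrightarrow> X \<subseteq> E \<and> f X = card X"
  by (auto simp: matroid_of_rank_def)

text \<open>By unit increase the only other possible value is \<open>card X + 1\<close>, which would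
  make \<open>insert y X\<close> independent.\<close>

lemma f_insert_nonindep:
  assumes "X \<subseteq> E" "f X = card X" "y \<in> E" "insert y X \<notin> indep_sets matroid_of_rank"
  shows "f (insert y X) = f X"
proof (cases "y \<in> X")
  case False
  have "finite X" using assms(1) finite_E finite_subset by blast
  then show ?thesis
    using assms False f_insert_ge[of X y] f_insert_le[of X y]
    by (auto simp: indep_matroid_of_rank)
qed (simp add: insert_absorb)

lemma is_matroid_matroid_of_rank: "is_matroid matroid_of_rank"
proof -
  \<comment> \<open>Adding the elements of \<open>X - Y\<close> to \<open>Y\<close> raises
    \<open>f\<close> by at most \<open>card (X - Y)\<close>, so \<open>f X = card X\<close> forces
    \<open>f Y\<close> up to \<open>card Y\<close>.\<close>
  have "Y \<in> indep_sets matroid_of_rank" if "X \<in> indep_sets matroid_of_rank" "Y \<subseteq> X" for X Y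
  proof -
    have X: "X \<subseteq> E" "f X = card X" "Y \<subseteq> E"
      using that by (auto simp: indep_matroid_of_rank)
    have "finite X" using X(1) finite_E finite_subset by blast
    then have "card X = card Y + card (X - Y)" "finite (X - Y)"
      using that(2) by (simp_all add: card_Diff_subset card_mono finite_subset)
    moreover have "Y \<union> (X - Y) = X" using that(2) by auto
    ultimately have "f X \<le> f Y + card (X - Y)" "card X = card Y + card (X - Y)"
      using f_Un[of "X - Y" Y] X by auto
    then show ?thesis using f_le_card[of Y] X by (auto simp: indep_matroid_of_rank)
  qed
  moreover have "\<exists>y \<in> Y - X. X \<union> {y} \<in> indep_sets matroid_of_rank"
    if "X \<in> indep_sets matroid_of_rank" "Y \<in> indep_sets matroid_of_rank" "card X < card Y" for X Y
  proof (rule ccontr)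
    assume neg: "\<not> ?thesis"
    have X: "X \<subseteq> E" "f X = card X" and Y: "Y \<subseteq> E" "f Y = card Y"
      using that by (auto simp: indep_matroid_of_rank)
    \<comment> \<open>If no element of \<open>Y\<close> extends \<open>X\<close>, none raises
      \<open>f\<close> above \<open>f X\<close>, so all of \<open>Y\<close> together does not
      either, although \<open>f Y\<close> is larger.\<close>
    have "f (X \<union> Y) = f X"
    proof (rule f_Un_eq)
      show "f (insert y X) = f X" if "y \<in> Y" for y
        using neg that X Y f_insert_nonindep[of X y] by (cases "y \<in> X") (auto simp: insert_absorb)
    qed (use X Y in \<open>auto intro: finite_subset[OF _ finite_E]\<close>)
    then show False using f_mono[of Y "X \<union> Y"] X Y that(3) by auto
  qed
  moreover have "indep_sets matroid_of_rank \<subseteq> Pow E" "{} \<in> indep_sets matroid_of_rank"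
    by (auto simp: indep_matroid_of_rank f_empty)
  ultimately show ?thesis
    unfolding is_matroid_def ground_matroid_of_rank using finite_E by blast
qed

text \<open>No element of \<open>A\<close> extends a maximum independent
  \<open>X \<subseteq> A\<close>, so \<open>f_Un_eq\<close> spreads the value
  \<open>f X = card X\<close> to all of \<open>A\<close>.\<close>

lemma matroid_rank_matroid_of_rank:
  assumes "A \<subseteq> E"
  shows "matroid_rank matroid_of_rank A = f A"
proof -
  interpret matroid matroid_of_rank
    by standard (rule is_matroid_matroid_of_rank)
  obtain X where X: "X \<in> indep_sets matroid_of_rank" "X \<subseteq> A" "card X = rk A"
    by (rule obtain_max_indep)
  have fX: "f X = card X" "X \<subseteq> E" using X(1) by (auto simp: indep_matroid_of_rank)
  have "f (X \<union> A) = f X"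
  proof (rule f_Un_eq)
    fix a assume a: "a \<in> A"
    show "f (insert a X) = f X"
    proof (cases "a \<in> X")
      case False
      have "card (insert a X) > rk A"
        using False X by (simp add: indep_finite)
      then have "insert a X \<notin> indep_sets matroid_of_rank"
        using card_le_rank[of "insert a X" A] a X(2) by auto
      then show ?thesis using f_insert_nonindep fX a assms by blast
    qed (simp add: insert_absorb)
  qed (use assms fX in \<open>auto intro: finite_subset[OF _ finite_E]\<close>)
  then show ?thesis using X fX by (simp add: Un_absorb1)
qed

end

section \<open>From semimatroids to pointed matroids\<close>

locale semimatroid =
  fixes S :: "'a set" and C :: "'a set set" and r :: "'a set \<Rightarrow> nat"
  assumes is_semimatroid: "is_semimatroid (S, C, r)"
begin

text \<open>In \<open>r_mono\<close> and \<open>r_submodular\<close> membership in \<open>C\<close>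
  is asked of the largest set; downward closure supplies it for the others.\<close>

lemma finite_S: "finite S"
  and C_subset: "X \<in> C \<Longrightarrow> X \<subseteq> S"
  and C_mono: "X \<in> C \<Longrightarrow> Y \<subseteq> X \<Longrightarrow> Y \<in> C"
  and r_extensional: "r \<in> extensional C"
  and r_le_card: "X \<in> C \<Longrightarrow> r X \<le> card X"
  and r_mono: "Y \<in> C \<Longrightarrow> X \<subseteq> Y \<Longrightarrow> r X \<le> r Y"
  and r_submodular: "X \<union> Y \<in> C \<Longrightarrow> r (X \<union> Y) + r (X \<inter> Y) \<le> r X + r Y"
  and CR1: "X \<in> C \<Longrightarrow> Y \<in> C \<Longrightarrow> r X = r (X \<inter> Y) \<Longrightarrow> X \<union> Y \<in> C"
  and CR2: "X \<in> C \<Longrightarrow> Y \<in> C \<Longrightarrow> r X < r Y \<Longrightarrow> \<exists>y \<in> Y - X. insert y X \<in> C"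
proof -
  have ax: "finite S" "simplicial_complex_on S C" "r \<in> C \<rightarrow>\<^sub>E UNIV"
    "\<forall>X \<in> C. r X \<le> card X"
    "\<forall>X \<in> C. \<forall>Y \<in> C. X \<subseteq> Y \<longrightarrow> r X \<le> r Y"
    "\<forall>X \<in> C. \<forall>Y \<in> C. X \<union> Y \<in> C \<longrightarrow> r (X \<union> Y) + r (X \<inter> Y) \<le> r X + r Y"
    "\<forall>X \<in> C. \<forall>Y \<in> C. r X = r (X \<inter> Y) \<longrightarrow> X \<union> Y \<in> C"
    "\<forall>X \<in> C. \<forall>Y \<in> C. r X < r Y \<longrightarrow> (\<exists>y \<in> Y - X. insert y X \<in> C)"
    using is_semimatroid unfolding is_semimatroid_def by auto
  show mono: "X \<in> C \<Longrightarrow> Y \<subseteq> X \<Longrightarrow> Y \<in> C" for X Y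
    using ax(2) unfolding simplicial_complex_on_def by blast
  show "X \<in> C \<Longrightarrow> X \<subseteq> S"
    using ax(2) unfolding simplicial_complex_on_def by blast
  show "Y \<in> C \<Longrightarrow> X \<subseteq> Y \<Longrightarrow> r X \<le> r Y"
    using ax(5) mono by blast
  show "X \<union> Y \<in> C \<Longrightarrow> r (X \<union> Y) + r (X \<inter> Y) \<le> r X + r Y" for X Y
    using ax(6) mono[of "X \<union> Y" X] mono[of "X \<union> Y" Y] by blast
  show "X \<in> C \<Longrightarrow> Y \<in> C \<Longrightarrow> r X = r (X \<inter> Y) \<Longrightarrow> X \<union> Y \<in> C"
    and "X \<in> C \<Longrightarrow> Y \<in> C \<Longrightarrow> r X < r Y \<Longrightarrow> \<exists>y \<in> Y - X. insert y X \<in> C"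
    using ax(7,8) by blast+
  show "finite S" "r \<in> extensional C" "X \<in> C \<Longrightarrow> r X \<le> card X"
    using ax(1,3,4) by (auto simp: PiE_def)
qed

lemma empty_in_C: "{} \<in> C"
proof -
  have "C \<noteq> {}" using is_semimatroid unfolding is_semimatroid_def by auto
  then show ?thesis using C_mono by blast
qed

lemma finite_C: "finite C"
  by (rule finite_subset[of _ "Pow S"]) (use C_subset finite_S in auto)

lemma r_empty: "r {} = 0"
  using r_le_card[OF empty_in_C] by simp

lemma r_insert_le: "insert x X \<in> C \<Longrightarrow> r (insert x X) \<le> r X + 1"
  using r_submodular[of X "{x}"] r_le_card[of "{x}"] C_mono[of "insert x X" "{x}"] by auto

text \<open>Strengthens (CR2): a set \<open>Z\<close> that is maximal between \<open>X\<close> and \<open>X \<union> Y\<close> with \<open>r Z = r X\<close> yields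
  an element raising the rank of \<open>Z\<close>, hence by submodularity that of \<open>X\<close>.\<close>

lemma CR2_rank:
  assumes X: "X \<in> C" and Y: "Y \<in> C" and less: "r X < r Y"
  shows "\<exists>y \<in> Y - X. insert y X \<in> C \<and> r (insert y X) = r X + 1"
proof -
  define F where "F = {Z \<in> C. X \<subseteq> Z \<and> Z \<subseteq> X \<union> Y \<and> r Z = r X}"
  have "finite F" "X \<in> F" using finite_C X by (auto simp: F_def)
  then obtain Z where Z: "Z \<in> F" and max: "\<And>W. W \<in> F \<Longrightarrow> Z \<subseteq> W \<Longrightarrow> Z = W"
    using finite_has_maximal[of F] by auto
  have ZC: "Z \<in> C" "X \<subseteq> Z" "Z \<subseteq> X \<union> Y" "r Z = r X" using Z by (auto simp: F_def)
  obtain y where y: "y \<in> Y - Z" "insert y Z \<in> C"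
    using CR2[OF ZC(1) Y] less ZC(4) by auto
  have XC: "insert y X \<in> C" using C_mono[OF y(2), of "insert y X"] ZC(2) by auto
  have "insert y Z \<notin> F" using max[of "insert y Z"] y(1) by auto
  then have "r Z < r (insert y Z)"
    using y ZC r_mono[OF y(2) subset_insertI] by (auto simp: F_def)
  moreover have "insert y X \<union> Z = insert y Z" "insert y X \<inter> Z = X"
    using ZC(2) y(1) by auto
  then have "r (insert y Z) + r X \<le> r (insert y X) + r Z"
    using r_submodular[of "insert y X" Z] y(2) by simp
  ultimately have "r (insert y X) = r X + 1"
    using r_insert_le[OF XC] by linarith
  then show ?thesis using y ZC(2) XC by auto
qed

section \<open>The maximal rank \<open>\<rho>\<close> below a set\<close>

abbreviation "\<rho> \<equiv> max_rank_below C r"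

lemma finite_ranks_below: "finite {r B | B. B \<subseteq> A \<and> B \<in> C}"
  by (rule finite_subset[of _ "r ` C"]) (use finite_C in auto)

lemma r_le_rho: "B \<in> C \<Longrightarrow> B \<subseteq> A \<Longrightarrow> r B \<le> \<rho> A"
  unfolding max_rank_below_def using finite_ranks_below by (intro Max_ge) auto

lemma obtain_rho:
  obtains B where "B \<in> C" "B \<subseteq> A" "r B = \<rho> A"
proof -
  have "\<rho> A \<in> {r B | B. B \<subseteq> A \<and> B \<in> C}"
    unfolding max_rank_below_def
    using finite_ranks_below empty_in_C by (intro Max_in) auto
  then show ?thesis using that by auto
qed

lemma rho_eq_r: "A \<in> C \<Longrightarrow> \<rho> A = r A"
  by (metis antisym obtain_rho order_refl r_le_rho r_mono)

lemma rho_mono: "A \<subseteq> B \<Longrightarrow> \<rho> A \<le> \<rho> B"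
  by (metis obtain_rho order_trans r_le_rho)

text \<open>Deleting \<open>x\<close> from a maximiser for \<open>insert x A\<close> costs at most
  one unit of rank and leaves a competitor for \<open>\<rho> A\<close>.\<close>

lemma rho_insert_le: "\<rho> (insert x A) \<le> \<rho> A + 1"
proof -
  obtain B where B: "B \<in> C" "B \<subseteq> insert x A" "r B = \<rho> (insert x A)"
    by (rule obtain_rho)
  have "r B \<le> r (B - {x}) + 1"
    using B(1) r_insert_le[of x "B - {x}"] by (cases "x \<in> B") (auto simp: insert_absorb)
  moreover have "r (B - {x}) \<le> \<rho> A"
    using B C_mono by (intro r_le_rho) auto
  ultimately show ?thesis using B(3) by linarith
qed

text \<open>\<open>CR2_rank\<close> is applied to maximisers \<open>D\<close> and \<open>F\<close>
  for \<open>A\<close> and \<open>B\<close>. The rank-raising form is essential: membership of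
  \<open>insert b D\<close> in \<open>C\<close> alone would not increase
  \<open>\<rho>\<close>.\<close>

lemma rho_augment:
  assumes "\<rho> A < \<rho> B"
  shows "\<exists>b \<in> B - A. \<rho> A < \<rho> (insert b A)"
proof -
  obtain D where D: "D \<in> C" "D \<subseteq> A" "r D = \<rho> A" by (rule obtain_rho)
  obtain F where F: "F \<in> C" "F \<subseteq> B" "r F = \<rho> B" by (rule obtain_rho)
  obtain b where b: "b \<in> F - D" "insert b D \<in> C" "r (insert b D) = r D + 1"
    using CR2_rank[OF D(1) F(1)] assms D F by auto
  have "\<rho> A < \<rho> (insert b A)"
    using r_le_rho[OF b(2) insert_mono[OF D(2)]] b(3) D(3) by simp
  \<comment> \<open>\<open>b\<close> was chosen only outside \<open>D\<close>; an element of
    \<open>A\<close> could not change \<open>\<rho> A\<close>.\<close>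
  moreover from this have "b \<notin> A" by (auto simp: insert_absorb)
  ultimately show ?thesis using b(1) F(2) by blast
qed

text \<open>Otherwise \<open>rho_augment\<close> would give an element raising
  \<open>\<rho> A\<close>, and it could only be \<open>x\<close> or \<open>y\<close>.\<close>

lemma rho_insert2:
  assumes "\<rho> (insert x A) = \<rho> A" "\<rho> (insert y A) = \<rho> A"
  shows "\<rho> (insert x (insert y A)) = \<rho> A"
  using rho_augment[of A "insert x (insert y A)"] rho_mono[of A "insert x (insert y A)"] assms
  by fastforce

text \<open>Leaving \<open>C\<close> already adds 1 to the extended rank, so unit increase needs
  \<open>\<rho>\<close> to stay put at that moment. A maximiser of larger rank would, by (CR2),
  supply an element of \<open>insert x A\<close> outside \<open>A\<close> that keeps
  \<open>A\<close> in \<open>C\<close>; this can only be \<open>x\<close>.\<close>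

lemma rho_insert_leaving:
  assumes "A \<in> C" "insert x A \<notin> C"
  shows "\<rho> (insert x A) = \<rho> A"
proof (rule ccontr)
  assume neq: "\<not> ?thesis"
  obtain B where B: "B \<in> C" "B \<subseteq> insert x A" "r B = \<rho> (insert x A)"
    by (rule obtain_rho)
  have "r A < r B"
    using neq rho_mono[OF subset_insertI, of A x] B(3) rho_eq_r[OF assms(1)] by auto
  then obtain b where "b \<in> B - A" "insert b A \<in> C"
    using CR2[OF assms(1) B(1)] by auto
  then show False using B(2) assms(2) by blast
qed

end

section \<open>The extended rank function and its local rank axioms\<close>

locale semimatroid_point = semimatroid S C r
  for S :: "'a set" and C r +
  fixes p :: 'a
  assumes p_notin_S: "p \<notin> S"
begin

abbreviation "f \<equiv> extended_rank p C r"

lemma extended_rank_S: "p \<notin> A \<Longrightarrow> f A = \<rho> A + (if A \<in> C then 0 else 1)"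
  by (simp add: extended_rank_def rank_on_S_def rho_eq_r)

text \<open>Both cases agree: the 1 comes from adding \<open>p\<close> if \<open>A \<in> C\<close>,
  and is already present in the rank of \<open>A\<close> otherwise.\<close>

lemma extended_rank_insert: "p \<notin> A \<Longrightarrow> f (insert p A) = \<rho> A + 1"
  by (simp add: extended_rank_def rank_on_S_def rho_eq_r)

lemma C_if_insert_in_C: "insert x A \<in> C \<Longrightarrow> A \<in> C"
  using C_mono by blast

lemma extended_rank_insert2:
  assumes p: "p \<notin> A" "x \<noteq> p" "y \<noteq> p" and neq: "x \<noteq> y" "x \<notin> A" "y \<notin> A"
    and eq: "f (insert x A) = f A" "f (insert y A) = f A"
  shows "f (insert x (insert y A)) = f A"
proof -
  \<comment> \<open>Neither \<open>\<rho>\<close> nor the term for lying outside \<open>C\<close>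
    can decrease under insertion, so equality of \<open>f\<close> splits into equality of
    both.\<close>
  have rho: "\<rho> (insert x A) = \<rho> A" "\<rho> (insert y A) = \<rho> A"
    and C: "insert x A \<in> C \<longleftrightarrow> A \<in> C" "insert y A \<in> C \<longleftrightarrow> A \<in> C"
    using eq p rho_mono[OF subset_insertI, of A x] rho_mono[OF subset_insertI, of A y] C_if_insert_in_C
    by (auto simp: extended_rank_S split: if_splits)
  have "insert x (insert y A) \<in> C \<longleftrightarrow> A \<in> C"
  proof
    assume A: "A \<in> C"
    \<comment> \<open>With \<open>A\<close> as intersection and equal ranks, (CR1) puts the union in
      \<open>C\<close>.\<close>
    have "insert x A \<inter> insert y A = A" using neq by auto
    then have "insert x A \<union> insert y A \<in> C"
      using C A rho by (intro CR1) (auto simp flip: rho_eq_r)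
    then show "insert x (insert y A) \<in> C" by (simp add: insert_commute)
  qed (use C_if_insert_in_C in blast)
  then show ?thesis using rho_insert2[OF rho] p by (simp add: extended_rank_S)
qed

text \<open>That \<open>p\<close> adds nothing means \<open>A \<notin> C\<close>; supersets of
  \<open>A\<close> then also lie outside \<open>C\<close>, and only \<open>\<rho>\<close> has to be
  compared.\<close>

lemma extended_rank_insert_insert:
  assumes p: "p \<notin> A" "x \<noteq> p" and eq: "f (insert x A) = f A" "f (insert p A) = f A"
  shows "f (insert x (insert p A)) = f A"
proof -
  have "A \<notin> C" using eq(2) p by (auto simp: extended_rank_S extended_rank_insert split: if_splits)
  then have "insert x A \<notin> C" using C_if_insert_in_C by blast
  then have "\<rho> (insert x A) = \<rho> A"
    using eq(1) p \<open>A \<notin> C\<close> by (simp add: extended_rank_S)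
  then show ?thesis
    using p \<open>A \<notin> C\<close> by (simp add: extended_rank_S extended_rank_insert insert_commute[of x p])
qed

text \<open>On sets containing \<open>p\<close> the axioms are those of \<open>\<rho>\<close>,
  shifted by 1. The remaining cases use the lemmas above, according to whether \<open>p\<close> is
  among the inserted elements.\<close>

sublocale local_rank "insert p S" f
proof
  show "finite (insert p S)" using finite_S by simp
  show "f {} = 0"
    using extended_rank_S[of "{}"] by (simp add: empty_in_C rho_eq_r r_empty)
next
  fix A x assume A: "A \<subseteq> insert p S" "x \<in> insert p S" "x \<notin> A"
  have "f A \<le> f (insert x A) \<and> f (insert x A) \<le> f A + 1"
  proof (cases "x = p")
    case True
    then show ?thesis using A by (simp add: extended_rank_S extended_rank_insert)
  next
    case xp: False
    show ?thesis
    proof (cases "p \<in> A")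
      case True
      then obtain B where "A = insert p B" "p \<notin> B" by (meson mk_disjoint_insert)
      then show ?thesis
        using xp rho_mono[OF subset_insertI, of B x] rho_insert_le[of x B]
        by (simp add: extended_rank_insert insert_commute[of x p])
    next
      case False
      then show ?thesis
        using xp rho_mono[OF subset_insertI, of A x] rho_insert_le[of x A] C_if_insert_in_C[of x A]
          rho_insert_leaving[of A x]
        by (auto simp: extended_rank_S)
    qed
  qed
  then show "f A \<le> f (insert x A)" "f (insert x A) \<le> f A + 1" by auto
next
  fix A x y
  assume A: "x \<notin> A" "y \<notin> A" "x \<noteq> y" and eq: "f (insert x A) = f A" "f (insert y A) = f A"
  show "f (insert x (insert y A)) = f A"
  proof (cases "p \<in> A")
    case True
    then obtain B where B: "A = insert p B" "p \<notin> B" by (meson mk_disjoint_insert)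
    have eqs: "insert x A = insert p (insert x B)" "insert y A = insert p (insert y B)"
      "insert x (insert y A) = insert p (insert x (insert y B))"
      using B(1) by auto
    have notin: "p \<notin> insert x B" "p \<notin> insert y B" "p \<notin> insert x (insert y B)"
      using A B by auto
    have "f A = \<rho> B + 1"
      unfolding B(1) using B(2) by (rule extended_rank_insert)
    moreover have "f (insert x A) = \<rho> (insert x B) + 1"
      unfolding eqs(1) using notin(1) by (rule extended_rank_insert)
    moreover have "f (insert y A) = \<rho> (insert y B) + 1"
      unfolding eqs(2) using notin(2) by (rule extended_rank_insert)
    moreover have "f (insert x (insert y A)) = \<rho> (insert x (insert y B)) + 1"
      unfolding eqs(3) using notin(3) by (rule extended_rank_insert)
    ultimately show ?thesis using eq rho_insert2[of x B y] by linarith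
  next
    case False
    consider "x = p" "y \<noteq> p" | "y = p" "x \<noteq> p" | "x \<noteq> p" "y \<noteq> p"
      using A(3) by blast
    then show ?thesis
    proof cases
      case 1
      then show ?thesis
        using False eq extended_rank_insert_insert[of A y] by (simp add: insert_commute)
    next
      case 2
      then show ?thesis using False eq extended_rank_insert_insert[of A x] by simp
    next
      case 3
      then show ?thesis using False A eq extended_rank_insert2[of A x y] by simp
    qed
  qed
qed

section \<open>The matroid with the extended rank, and the way back to the semimatroid\<close>

lemma has_extended_rank_iff:
  "has_extended_rank p (S, C, r) N \<longleftrightarrow>
    is_matroid N \<and> ground N = S \<union> {p} \<and> is_rank_function_of f N"
proof -
  have "(\<forall>A \<subseteq> S. (A \<in> C \<longrightarrow> g A = r A \<and> g (A \<union> {p}) = r A + 1) \<and>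
           (A \<notin> C \<longrightarrow> g A = \<rho> A + 1 \<and> g (A \<union> {p}) = \<rho> A + 1)) \<longleftrightarrow>
        (\<forall>A \<subseteq> S \<union> {p}. f A = g A)" (is "?L \<longleftrightarrow> ?R") for g :: "'a set \<Rightarrow> nat"
  proof
    assume L: ?L
    show ?R
    proof (intro allI impI)
      fix A assume "A \<subseteq> S \<union> {p}"
      then have sub: "A - {p} \<subseteq> S" and "A = A - {p} \<or> A = (A - {p}) \<union> {p}" by auto
      then show "f A = g A"
        using L[rule_format, OF sub] extended_rank_S[of "A - {p}"] extended_rank_insert[of "A - {p}"]
        by (cases "A - {p} \<in> C") (auto simp: rho_eq_r insert_absorb)
    qed
  next
    assume R: ?R
    show ?L
    proof (intro allI impI)
      fix A assume A: "A \<subseteq> S"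
      have "p \<notin> A" using A p_notin_S by auto
      moreover have "A \<subseteq> S \<union> {p}" "insert p A \<subseteq> S \<union> {p}" using A by auto
      then have "f A = g A" "f (insert p A) = g (insert p A)" using R by blast+
      ultimately show "(A \<in> C \<longrightarrow> g A = r A \<and> g (A \<union> {p}) = r A + 1) \<and>
           (A \<notin> C \<longrightarrow> g A = \<rho> A + 1 \<and> g (A \<union> {p}) = \<rho> A + 1)"
        by (auto simp: extended_rank_S extended_rank_insert rho_eq_r)
    qed
  qed
  then show ?thesis
    by (auto simp: has_extended_rank_def is_rank_function_of_def)
qed

lemma has_extended_rank_matroid_of_rank: "has_extended_rank p (S, C, r) matroid_of_rank"
  unfolding has_extended_rank_iff
  by (simp add: is_matroid_matroid_of_rank is_rank_function_of_def matroid_rank_matroid_of_rank)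

lemma has_extended_rank_unique:
  assumes "has_extended_rank p (S, C, r) N" "has_extended_rank p (S, C, r) N'"
  shows "N = N'"
  by (rule matroid_eqI) (use assms in \<open>auto simp: has_extended_rank_iff is_rank_function_of_def\<close>)

text \<open>Uniqueness lets the definite description in \<open>pointed_of_semimat\<close> be
  evaluated.\<close>

lemma pointed_of_semimat_eq:
  "has_extended_rank p (S, C, r) N \<Longrightarrow> pointed_of_semimat p (S, C, r) = (N, p)"
  unfolding pointed_of_semimat_def
  using the_equality[of "has_extended_rank p (S, C, r)" N] has_extended_rank_unique by blast

text \<open>Since \<open>{} \<in> C\<close> has rank 0, the extended rank of \<open>{p}\<close> is
  1, so \<open>p\<close> is not a loop.\<close>

lemma Pointedmat_if_has_extended_rank:
  assumes "has_extended_rank p (S, C, r) N"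
  shows "(N, p) \<in> Pointedmat S p"
proof -
  interpret N: matroid N
    by standard (use assms in \<open>simp add: has_extended_rank_iff\<close>)
  have "f (insert p {}) = 1"
    using empty_in_C by (subst extended_rank_insert) (simp_all add: rho_eq_r r_empty)
  then have "N.rk {p} = 1"
    using assms by (auto simp: has_extended_rank_iff is_rank_function_of_def)
  then show ?thesis
    using assms N.indep_iff_rank[of "{p}"]
    by (auto simp: Pointedmat_def is_loop_def has_extended_rank_iff)
qed

text \<open>Adding \<open>p\<close> raises the rank of \<open>A \<subseteq> S\<close> exactly when
  \<open>A \<in> C\<close>. The ranks then agree as functions because \<open>r\<close> is
  extensional on \<open>C\<close>.\<close>

lemma semimat_of_pointed_has_extended_rank:
  assumes "has_extended_rank p (S, C, r) N"
  shows "semimat_of_pointed S (N, p) = (S, C, r)"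
proof -
  have ranks: "matroid_rank N A = r A" "matroid_rank N (insert p A) = r A + 1" if "A \<in> C" for A
    using assms that C_subset[OF that] by (auto simp: has_extended_rank_def)
  have "matroid_rank N (insert p A) = matroid_rank N A" if "A \<subseteq> S" "A \<notin> C" for A
    using assms that by (auto simp: has_extended_rank_def)
  moreover have "A \<in> pointed_complex S (N, p) \<longleftrightarrow>
      A \<subseteq> S \<and> matroid_rank N (insert p A) \<noteq> matroid_rank N A" for A
    using assms by (auto simp: pointed_complex_def matroid_cl_def has_extended_rank_def)
  ultimately have "A \<in> pointed_complex S (N, p) \<longleftrightarrow> A \<in> C" for A
    using ranks[of A] C_subset[of A] by (cases "A \<in> C") auto
  then have "pointed_complex S (N, p) = C" by blast
  moreover have "restrict (matroid_rank N) C = r"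
    using ranks(1) r_extensional by (intro extensionalityI[of _ C]) auto
  ultimately show ?thesis by (simp add: semimat_of_pointed_def)
qed

end

section \<open>From pointed matroids to semimatroids\<close>

locale pointed_matroid = matroid N for N :: "'a matroid" +
  fixes S :: "'a set" and p :: 'a
  assumes p_notin_S: "p \<notin> S"
    and ground_eq: "ground N = S \<union> {p}"
    and p_indep: "{p} \<in> indep_sets N"
begin

definition "C = {A. A \<subseteq> S \<and> p \<notin> matroid_cl N A}"

lemma in_C_iff: "A \<in> C \<longleftrightarrow> A \<subseteq> S \<and> rk (insert p A) = rk A + 1"
  using rank_insert_if_notin_cl[of p A] ground_eq by (auto simp: C_def in_cl_iff)

lemma rank_insert_notin_C: "A \<subseteq> S \<Longrightarrow> A \<notin> C \<Longrightarrow> rk (insert p A) = rk A"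
  by (auto simp: C_def in_cl_iff)

text \<open>Submodularity for \<open>X\<close> and \<open>insert p Y\<close>: adding
  \<open>p\<close> raises the rank of the smaller set at least as much as that of the
  larger.\<close>

lemma C_downclosed:
  assumes "X \<in> C" "Y \<subseteq> X"
  shows "Y \<in> C"
proof -
  have "X \<union> insert p Y = insert p X" "X \<inter> insert p Y = Y"
    using assms p_notin_S by (auto simp: in_C_iff)
  then have "rk (insert p X) + rk Y \<le> rk X + rk (insert p Y)"
    using rank_submodular[of X "insert p Y"] by simp
  then show ?thesis
    using assms rank_insert_le[of p Y] by (auto simp: in_C_iff)
qed

text \<open>Submodularity gives \<open>rk (X \<union> Y) \<le> rk Y\<close>, while
  \<open>insert p (X \<union> Y)\<close> has rank at least \<open>rk Y + 1\<close>.\<close>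

lemma C_CR1:
  assumes X: "X \<in> C" and Y: "Y \<in> C" and eq: "rk X = rk (X \<inter> Y)"
  shows "X \<union> Y \<in> C"
proof -
  have "rk (X \<union> Y) \<le> rk Y" using rank_submodular[of X Y] eq by simp
  moreover have "rk (insert p Y) \<le> rk (insert p (X \<union> Y))" by (rule rank_mono) auto
  ultimately show ?thesis
    using X Y rank_insert_le[of p "X \<union> Y"] by (auto simp: in_C_iff)
qed

text \<open>Here submodularity for \<open>A \<union> Z\<close> and \<open>insert z A\<close> does
  the induction step, as their intersection contains \<open>A\<close>.\<close>

lemma rank_Un_eq:
  assumes "finite Z" "\<And>z. z \<in> Z \<Longrightarrow> rk (insert z A) = rk A"
  shows "rk (A \<union> Z) = rk A"
  using assms
proof (induction Z rule: finite_induct)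
  case (insert z Z)
  have "A \<union> Z \<union> insert z A = A \<union> insert z Z" by auto
  then have "rk (A \<union> insert z Z) + rk ((A \<union> Z) \<inter> insert z A) \<le> rk A + rk A"
    using rank_submodular[of "A \<union> Z" "insert z A"] insert by simp
  moreover have "rk A \<le> rk ((A \<union> Z) \<inter> insert z A)" "rk A \<le> rk (A \<union> insert z Z)"
    by (rule rank_mono, blast)+
  ultimately show ?case by linarith
qed simp

text \<open>If no such \<open>y\<close> exists, \<open>insert p X\<close> spans \<open>Y\<close>.
  Then \<open>insert p Y\<close>, of rank \<open>rk Y + 1\<close>, has rank at most
  \<open>rk X + 1\<close>.\<close>

lemma C_CR2:
  assumes X: "X \<in> C" and Y: "Y \<in> C" and less: "rk X < rk Y"
  shows "\<exists>y \<in> Y - X. insert y X \<in> C"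
proof (rule ccontr)
  assume neg: "\<not> ?thesis"
  have sub: "X \<subseteq> S" "Y \<subseteq> S" and rX: "rk (insert p X) = rk X + 1"
    and rY: "rk (insert p Y) = rk Y + 1"
    using X Y by (auto simp: in_C_iff)
  have fin: "finite Y"
    using sub ground_eq finite_subset[OF _ finite_ground, of Y] by auto
  have "rk (insert p X \<union> Y) = rk (insert p X)"
  proof (rule rank_Un_eq[OF fin])
    fix y assume y: "y \<in> Y"
    show "rk (insert y (insert p X)) = rk (insert p X)"
    proof (cases "y \<in> X")
      case False
      then have "insert y X \<notin> C" using neg y by blast
      \<comment> \<open>As \<open>p\<close> adds nothing to \<open>insert y X\<close>, the rank is
        at most \<open>rk X + 1\<close>, the rank of \<open>insert p X\<close>.\<close>
      then have "rk (insert p (insert y X)) = rk (insert y X)"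
        using sub y by (intro rank_insert_notin_C) auto
      moreover have "rk (insert p X) \<le> rk (insert p (insert y X))" by (rule rank_mono) auto
      ultimately show ?thesis
        using rank_insert_le[of y X] rX by (simp add: insert_commute)
    qed (simp add: insert_absorb insert_commute)
  qed
  moreover have "rk (insert p Y) \<le> rk (insert p X \<union> Y)" by (rule rank_mono) auto
  ultimately show False using rX rY less by simp
qed

lemma empty_in_C: "{} \<in> C"
  unfolding in_C_iff using indep_iff_rank[of "{p}"] p_indep by (simp add: rank_empty)

lemma is_semimatroid_C: "is_semimatroid (S, C, restrict rk C)"
proof -
  have fin: "finite S" using finite_ground ground_eq by simp
  have sub: "C \<subseteq> Pow S" by (auto simp: in_C_iff)
  have Int: "X \<inter> Y \<in> C" if "X \<in> C" for X Y
    using that by (rule C_downclosed) auto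
  show ?thesis
    unfolding is_semimatroid_def prod.case
  proof (intro conjI ballI impI)
    show "simplicial_complex_on S C"
      unfolding simplicial_complex_on_def using sub C_downclosed by blast
    show "C \<noteq> {}" using empty_in_C by blast
  next
    fix X assume X: "X \<in> C"
    have "finite X" using X sub fin by (meson PowD finite_subset subsetD)
    then show "restrict rk C X \<le> card X" using X by (simp add: rank_le_card)
  next
    fix X Y assume X: "X \<in> C" and Y: "Y \<in> C"
    show "restrict rk C X \<le> restrict rk C Y" if "X \<subseteq> Y"
      using X Y that by (simp add: rank_mono)
    show "restrict rk C (X \<union> Y) + restrict rk C (X \<inter> Y) \<le> restrict rk C X + restrict rk C Y"
      if "X \<union> Y \<in> C"
      using X Y that Int[OF X] by (simp add: rank_submodular)
    show "X \<union> Y \<in> C" if "restrict rk C X = restrict rk C (X \<inter> Y)"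
      using that X Int[OF X] by (intro C_CR1[OF X Y]) simp
    show "\<exists>y \<in> Y - X. X \<union> {y} \<in> C" if "restrict rk C X < restrict rk C Y"
      using that X Y C_CR2[OF X Y] by simp
  qed (simp_all add: fin)
qed

text \<open>From here on \<open>\<rho>\<close> is the maximal rank taken over this
  \<open>C\<close>.\<close>

sublocale semimatroid_point S C "restrict rk C" p
  by unfold_locales (rule is_semimatroid_C, rule p_notin_S)

text \<open>A basis of \<open>A \<union> {p}\<close> containing \<open>p\<close> attains the maximum defining \<open>\<rho> A\<close>.\<close>

lemma rho_notin_C:
  assumes A: "A \<subseteq> S" "A \<notin> C"
  shows "\<rho> A + 1 = rk A"
proof (rule antisym)
  obtain B where B: "B \<in> C" "B \<subseteq> A" "restrict rk C B = \<rho> A" by (rule obtain_rho)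
  have "\<rho> A + 1 = rk (insert p B)" using B by (simp add: in_C_iff)
  also have "\<dots> \<le> rk (insert p A)" using B(2) by (intro rank_mono) auto
  also have "\<dots> = rk A" using A by (rule rank_insert_notin_C)
  finally show "\<rho> A + 1 \<le> rk A" .
next
  obtain X where X: "X \<in> indep_sets N" "{p} \<subseteq> X" "X \<subseteq> insert p A" "card X = rk (insert p A)"
    using obtain_basis[OF p_indep, of "insert p A"] by auto
  define B where "B = X - {p}"
  have B: "B \<subseteq> A" "insert p B = X" "p \<notin> B" using X by (auto simp: B_def)
  have "B \<in> indep_sets N" using X(1) by (rule indep_mono) (auto simp: B_def)
  then have "rk B = card B" "rk X = card X" "card X = card B + 1"
    using X(1) B indep_finite[of B] by (auto simp: indep_iff_rank)
  then have "B \<in> C" "rk A = rk B + 1"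
    using A B X(4) rank_insert_notin_C[OF A] by (auto simp: in_C_iff)
  then show "rk A \<le> \<rho> A + 1"
    using r_le_rho[of B A] B(1) by simp
qed

text \<open>\<open>N\<close> itself meets the specification built from its own semimatroid, so by
  uniqueness the round trip from pointed matroids returns \<open>N\<close>.\<close>

lemma has_extended_rank_pointed: "has_extended_rank p (S, C, restrict rk C) N"
  unfolding has_extended_rank_def prod.case
proof (intro conjI allI impI)
  fix A assume A: "A \<subseteq> S"
  show "rk A = restrict rk C A" "rk (A \<union> {p}) = restrict rk C A + 1" if "A \<in> C"
    using that in_C_iff[of A] by simp_all
  show "rk A = \<rho> A + 1" "rk (A \<union> {p}) = \<rho> A + 1" if "A \<notin> C"
    using rho_notin_C[OF A that] rank_insert_notin_C[OF A that] by simp_all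
qed (use is_matroid ground_eq in auto)

end

theorem theorem5p4:
  fixes S :: "'a set" and p :: 'a
  assumes "finite S" and "p \<notin> S"
  shows
    "(\<forall>N. (N, p) \<in> Pointedmat S p \<longrightarrow>
        (let C = {A. A \<subseteq> S \<and> p \<notin> matroid_cl N A}
         in is_semimatroid (S, C, restrict (matroid_rank N) C))) \<and>
     (\<forall>C r. (S, C, r) \<in> Semimat S \<longrightarrow>
        (\<exists>N. is_matroid N \<and> ground N = S \<union> {p} \<and>
             is_rank_function_of (extended_rank p C r) N \<and>
             (N, p) \<in> Pointedmat S p)) \<and>
     ((\<forall>M \<in> Semimat S. \<exists>!N. has_extended_rank p M N) \<and>
      semimat_of_pointed S \<in> Pointedmat S p \<rightarrow> Semimat S \<and>
      pointed_of_semimat p \<in> Semimat S \<rightarrow> Pointedmat S p \<and>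
      (\<forall>x \<in> Pointedmat S p. pointed_of_semimat p (semimat_of_pointed S x) = x) \<and>
      (\<forall>M \<in> Semimat S. semimat_of_pointed S (pointed_of_semimat p M) = M) \<and>
      bij_betw (semimat_of_pointed S) (Pointedmat S p) (Semimat S) \<and>
      bij_betw (pointed_of_semimat p) (Semimat S) (Pointedmat S p))"
proof -
  have sm: "semimatroid_point S C r p" if "(S, C, r) \<in> Semimat S" for C r
    using that assms(2) by unfold_locales (simp add: Semimat_def)
  have pm: "pointed_matroid N S p" if "(N, p) \<in> Pointedmat S p" for N
    using that assms(2) by unfold_locales (auto simp: Pointedmat_def is_loop_def)
  have fst_eq: "\<exists>C r. M = (S, C, r)" if "M \<in> Semimat S" for M
    using that by (auto simp: Semimat_def)
  have snd_eq: "\<exists>N. x = (N, p)" if "x \<in> Pointedmat S p" for x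
    using that by (auto simp: Pointedmat_def)
  have of_pointed: "semimat_of_pointed S x \<in> Semimat S"
      "pointed_of_semimat p (semimat_of_pointed S x) = x" if x: "x \<in> Pointedmat S p" for x
  proof -
    obtain N where N: "x = (N, p)" using snd_eq[OF x] by blast
    interpret pointed_matroid N S p using pm x N by simp
    have eq: "semimat_of_pointed S x = (S, C, restrict rk C)"
      by (simp add: N semimat_of_pointed_def pointed_complex_def C_def)
    show "semimat_of_pointed S x \<in> Semimat S"
      using is_semimatroid_C by (simp add: eq Semimat_def)
    show "pointed_of_semimat p (semimat_of_pointed S x) = x"
      unfolding eq using pointed_of_semimat_eq[OF has_extended_rank_pointed] by (simp add: N)
  qed
  have of_semimat: "pointed_of_semimat p M \<in> Pointedmat S p"
      "semimat_of_pointed S (pointed_of_semimat p M) = M"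
      "\<exists>!N. has_extended_rank p M N" if M: "M \<in> Semimat S" for M
  proof -
    obtain C r where Cr: "M = (S, C, r)" using fst_eq[OF M] by blast
    interpret semimatroid_point S C r p using sm M Cr by simp
    note ext = has_extended_rank_matroid_of_rank
    have eq: "pointed_of_semimat p M = (matroid_of_rank, p)"
      unfolding Cr by (rule pointed_of_semimat_eq[OF ext])
    show "pointed_of_semimat p M \<in> Pointedmat S p"
      unfolding eq by (rule Pointedmat_if_has_extended_rank[OF ext])
    show "semimat_of_pointed S (pointed_of_semimat p M) = M"
      unfolding eq using semimat_of_pointed_has_extended_rank[OF ext] by (simp add: Cr)
    show "\<exists>!N. has_extended_rank p M N"
      unfolding Cr using ext has_extended_rank_unique by blast
  qed
  have "\<exists>N. is_matroid N \<and> ground N = S \<union> {p} \<and> is_rank_function_of (extended_rank p C r) N \<and>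
      (N, p) \<in> Pointedmat S p" if M: "(S, C, r) \<in> Semimat S" for C r
  proof -
    interpret semimatroid_point S C r p using sm M .
    show ?thesis
      using Pointedmat_if_has_extended_rank[OF has_extended_rank_matroid_of_rank]
        has_extended_rank_matroid_of_rank[unfolded has_extended_rank_iff] by blast
  qed
  moreover have "let C = {A. A \<subseteq> S \<and> p \<notin> matroid_cl N A}
      in is_semimatroid (S, C, restrict (matroid_rank N) C)" if "(N, p) \<in> Pointedmat S p" for N
  proof -
    interpret pointed_matroid N S p using pm that .
    show ?thesis using is_semimatroid_C by (simp add: C_def)
  qed
  moreover have "bij_betw (semimat_of_pointed S) (Pointedmat S p) (Semimat S)"
    by (rule bij_betw_byWitness[where f' = "pointed_of_semimat p"])
      (use of_pointed of_semimat in auto)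
  moreover have "bij_betw (pointed_of_semimat p) (Semimat S) (Pointedmat S p)"
    by (rule bij_betw_byWitness[where f' = "semimat_of_pointed S"])
      (use of_pointed of_semimat in auto)
  ultimately show ?thesis using of_pointed of_semimat by blast
qed

end
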